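(* Let $(F,\le)$ be an ordered field and let $k,l,n$ be positive integers with $k\ge l$. For every $A\in M_{k,n}(F)$ and $B\in M_{l,n}(F)$, we have $A\sim_n B$ if and only if $A=CB$ for some bibounded matrix $C\in M_{k,l}(F)$.
   Context: Let $M_{m,n}(F)$ be the set of $m\times n$ matrices over $F$ and $M_{\ast,n}(F)=\bigcup_{m\ge 1}M_{m,n}(F)$. A symmetric matrix $S\in M_n(F)$ is positive semidefinite if $v^TSv\ge 0$ for all $v\in F^n$; for symmetric $S,T\in M_n(F)$ write $S\le_n T$ iff $T-S$ is positive semidefinite. For $A,B\in M_{\ast,n}(F)$ (possibly with different numbers of rows) write $A\succeq_n B$ iff there is $r\in\mathbb N$ such that $A^TA\le_n rB^TB$, and $A\sim_n B$ iff $A\succeq_n B$ and $B\succeq_n A$. A matrix $C\in M_{k,l}(F)$ is called bibounded if $C\sim_l I_l$, where $I_l$ is the $l\times l$ identity matrix. *)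

theory Defs
  imports "Jordan_Normal_Form.Matrix"
begin

definition sym_mats :: "nat \<Rightarrow> 'a mat set" where
  "sym_mats n = {S \<in> carrier_mat n n. S\<^sup>T = S}"

definition pos_semidef :: "nat \<Rightarrow> 'a :: linordered_field mat \<Rightarrow> bool" where
  "pos_semidef n S \<longleftrightarrow>
     S \<in> sym_mats n \<and> (\<forall>v \<in> carrier_vec n. v \<bullet> (S *\<^sub>v v) \<ge> 0)"

text \<open>The order \<open>\<le>\<^sub>n\<close> on symmetric matrices; it is unrelated to the
  entrywise order that the library attaches to \<open>\<le>\<close> on matrices.\<close>

definition loewner_le :: "nat \<Rightarrow> 'a :: linordered_field mat \<Rightarrow> 'a mat \<Rightarrow> bool" where
  "loewner_le n S T \<longleftrightarrow> S \<in> sym_mats n \<and> T \<in> sym_mats n \<and> pos_semidef n (T - S)"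

text \<open>\<open>M\<^bsub>*,n\<^esub>(F)\<close>: matrices with \<open>n\<close> columns and any positive number of rows.\<close>

definition mats_with_cols :: "nat \<Rightarrow> 'a mat set" where
  "mats_with_cols n = (\<Union>m \<in> {1..}. carrier_mat m n)"

text \<open>The relation \<open>A \<succeq>\<^sub>n B\<close>. The field may be non-Archimedean, so it matters that the
  factor \<open>r\<close> is a natural number.\<close>

definition mat_succeq :: "nat \<Rightarrow> 'a :: linordered_field mat \<Rightarrow> 'a mat \<Rightarrow> bool" where
  "mat_succeq n A B \<longleftrightarrow>
     A \<in> mats_with_cols n \<and> B \<in> mats_with_cols n \<and>
     (\<exists>r :: nat. loewner_le n (A\<^sup>T * A) (of_nat r \<cdot>\<^sub>m (B\<^sup>T * B)))"

definition mat_sim :: "nat \<Rightarrow> 'a :: linordered_field mat \<Rightarrow> 'a mat \<Rightarrow> bool" where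
  "mat_sim n A B \<longleftrightarrow> mat_succeq n A B \<and> mat_succeq n B A"

definition bibounded :: "nat \<Rightarrow> nat \<Rightarrow> 'a :: linordered_field mat \<Rightarrow> bool" where
  "bibounded k l C \<longleftrightarrow> C \<in> carrier_mat k l \<and> mat_sim l C (1\<^sub>m l)"

end

theory Submission
  imports Defs "Jordan_Normal_Form.Determinant"
begin

text \<open>
  Write \<open>|x|\<^sup>2\<close> for \<open>x \<bullet> x\<close>. Then \<open>A \<succeq>\<^sub>n B\<close> says \<open>|A v|\<^sup>2 \<le> r |B v|\<^sup>2\<close> for all \<open>v\<close> and some
  natural number \<open>r\<close> (lemma \<open>mat_succeq_iff\<close>). So a bibounded \<open>C\<close> distorts \<open>|x|\<^sup>2\<close> only by factors
  bounded by natural numbers, and taking \<open>x = B v\<close> gives \<open>C B \<sim>\<^sub>n B\<close>.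

  Conversely, let \<open>A \<sim>\<^sub>n B\<close>. Then \<open>A\<close> and \<open>B\<close> have the same kernel, so \<open>B v \<mapsto> A v\<close> is a
  well-defined map on the column space of \<open>B\<close>, and it has the required bounds there. If the columns
  of \<open>B\<close> span \<open>F\<^sup>l\<close>, this map is the required \<open>C\<close>; in matrices, \<open>C = A R\<close> where \<open>B R = 1\<close>
  (lemma \<open>bibounded_factor_if_onto\<close>).

  Otherwise there is \<open>u \<noteq> 0\<close> orthogonal to the columns of \<open>B\<close>. Since \<open>A\<close> and \<open>B\<close> have the same
  rank, which is then less than \<open>l \<le> k\<close>, there is also \<open>w \<noteq> 0\<close> orthogonal to the columns of \<open>A\<close>
  (lemma \<open>defect_transfers\<close>). One wants to prescribe \<open>C u = w\<close>, which amounts to adjoining \<open>w\<close> to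
  \<open>A\<close> and \<open>u\<close> to \<open>B\<close> as a further column. By orthogonality this preserves \<open>\<sim>\<close>, provided that
  \<open>|u|\<^sup>2\<close> and \<open>|w|\<^sup>2\<close> are comparable up to natural factors.

  This comparability is the delicate point: square roots need not exist, and in a non-Archimedean
  field a positive element need not lie between two positive rationals after multiplication by a
  square. But \<open>|u|\<^sup>2\<close> is a sum of \<open>l\<close> squares, and dividing \<open>u\<close> by its largest coordinate in
  absolute value makes this sum a number between \<open>1\<close> and \<open>l\<close>
  (lemma \<open>exists_bounded_rescaling\<close>).

  The process ends because the adjoined columns \<open>u\<close> are nonzero and pairwise orthogonal, and \<open>F\<^sup>l\<close>
  has at most \<open>l\<close> such vectors (lemma \<open>orthogonal_list_length_le\<close>).
\<close>

section \<open>Quadratic forms and the preorder\<close>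

lemma self_scalar_prod_nonneg: "(v :: 'a :: linordered_field vec) \<bullet> v \<ge> 0"
  by (auto simp: scalar_prod_def intro!: sum_nonneg)

lemma self_scalar_prod_eq_0:
  fixes v :: "'a :: linordered_field vec"
  assumes "v \<in> carrier_vec n" "v \<bullet> v = 0"
  shows "v = 0\<^sub>v n"
  using assms by (auto simp: scalar_prod_def sum_nonneg_eq_0_iff)

lemma mult_mat_zero_vec:
  "M \<in> carrier_mat k n \<Longrightarrow> M *\<^sub>v 0\<^sub>v n = (0\<^sub>v k :: 'a :: semiring_0 vec)"
  by (intro eq_vecI) auto

lemma mat_eq_if_mult_vec_eq:
  fixes A B :: "'a :: comm_semiring_1 mat"
  assumes A: "A \<in> carrier_mat k n" and B: "B \<in> carrier_mat k n"
    and eq: "\<And>v. v \<in> carrier_vec n \<Longrightarrow> A *\<^sub>v v = B *\<^sub>v v"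
  shows "A = B"
proof (rule eq_matI)
  fix i j assume "i < dim_row B" "j < dim_col B"
  then have ij: "i < k" "j < n" using B by auto
  then show "A $$ (i, j) = B $$ (i, j)"
    using arg_cong[OF eq[of "unit_vec n j"], of "\<lambda>x. x $ i"] A B by simp
qed (use A B in auto)

lemma scalar_prod_gram:
  fixes A :: "'a :: comm_semiring_1 mat"
  assumes "A \<in> carrier_mat k n" "v \<in> carrier_vec n"
  shows "v \<bullet> ((A\<^sup>T * A) *\<^sub>v v) = (A *\<^sub>v v) \<bullet> (A *\<^sub>v v)"
proof -
  have "(A\<^sup>T * A) *\<^sub>v v = A\<^sup>T *\<^sub>v (A *\<^sub>v v)"
    using assms by (intro assoc_mult_mat_vec[of _ n k _ n]) auto
  then have "v \<bullet> ((A\<^sup>T * A) *\<^sub>v v) = (A\<^sup>T *\<^sub>v (A *\<^sub>v v)) \<bullet> v"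
    using assms by (simp add: comm_scalar_prod[of _ n])
  also have "\<dots> = (A *\<^sub>v v) \<bullet> (A *\<^sub>v v)"
    using assms by (intro transpose_vec_mult_scalar) auto
  finally show ?thesis .
qed

lemma mat_succeq_iff:
  fixes A B :: "'a :: linordered_field mat"
  assumes "k > 0" "l > 0" and A: "A \<in> carrier_mat k n" and B: "B \<in> carrier_mat l n"
  shows "mat_succeq n A B \<longleftrightarrow>
    (\<exists>r :: nat. \<forall>v \<in> carrier_vec n. (A *\<^sub>v v) \<bullet> (A *\<^sub>v v) \<le> of_nat r * ((B *\<^sub>v v) \<bullet> (B *\<^sub>v v)))"
proof -
  have cols: "A \<in> mats_with_cols n" "B \<in> mats_with_cols n"
    using assms by (force simp: mats_with_cols_def)+
  have sA: "A\<^sup>T * A \<in> sym_mats n"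
    using A by (auto simp: sym_mats_def transpose_mult[of _ n k _ n])
  have sB: "of_nat r \<cdot>\<^sub>m (B\<^sup>T * B) \<in> sym_mats n" for r :: nat
  proof -
    have "(of_nat r \<cdot>\<^sub>m (B\<^sup>T * B))\<^sup>T = of_nat r \<cdot>\<^sub>m (B\<^sup>T * B)\<^sup>T"
      by (intro eq_matI) auto
    then show ?thesis
      using B transpose_mult[of "B\<^sup>T" n l B n] by (simp add: sym_mats_def)
  qed
  have sD: "of_nat r \<cdot>\<^sub>m (B\<^sup>T * B) - A\<^sup>T * A \<in> sym_mats n" for r :: nat
    using sA sB[of r] A B by (auto simp: sym_mats_def transpose_minus[of _ n n])
  have q: "v \<bullet> ((of_nat r \<cdot>\<^sub>m (B\<^sup>T * B) - A\<^sup>T * A) *\<^sub>v v)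
      = of_nat r * ((B *\<^sub>v v) \<bullet> (B *\<^sub>v v)) - (A *\<^sub>v v) \<bullet> (A *\<^sub>v v)"
    if v: "v \<in> carrier_vec n" for v and r :: nat
  proof -
    have "(of_nat r \<cdot>\<^sub>m (B\<^sup>T * B)) *\<^sub>v v = of_nat r \<cdot>\<^sub>v ((B\<^sup>T * B) *\<^sub>v v)"
      using B v by (intro eq_vecI) (auto simp del: assoc_mult_mat_vec)
    then have "(of_nat r \<cdot>\<^sub>m (B\<^sup>T * B) - A\<^sup>T * A) *\<^sub>v v
        = of_nat r \<cdot>\<^sub>v ((B\<^sup>T * B) *\<^sub>v v) - (A\<^sup>T * A) *\<^sub>v v"
      using A B v by (simp add: minus_mult_distrib_mat_vec[of _ n n] del: assoc_mult_mat_vec)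
    moreover have "(B\<^sup>T * B) *\<^sub>v v \<in> carrier_vec n" "(A\<^sup>T * A) *\<^sub>v v \<in> carrier_vec n"
      using A B v by simp_all
    ultimately show ?thesis
      using v scalar_prod_gram[OF A v] scalar_prod_gram[OF B v]
      by (simp add: scalar_prod_minus_distrib[of _ n] del: assoc_mult_mat_vec)
  qed
  show ?thesis
    using cols sA sB sD by (auto simp: mat_succeq_def loewner_le_def pos_semidef_def q)
qed

section \<open>Kernels, orthogonality and rescaling\<close>

lemma wide_mat_kernel_nontrivial:
  fixes M :: "'a :: field mat"
  assumes M: "M \<in> carrier_mat l k" and "l < k"
  shows "\<exists>x \<in> carrier_vec k. x \<noteq> 0\<^sub>v k \<and> M *\<^sub>v x = 0\<^sub>v l"
proof -
  \<comment> \<open>Padding with zero rows gives a square matrix that is singular because its row \<open>l\<close> vanishes.\<close>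
  define N where "N = mat k k (\<lambda>(i, j). if i < l then M $$ (i, j) else 0)"
  have N: "N \<in> carrier_mat k k" by (simp add: N_def)
  have "N\<^sup>T *\<^sub>v unit_vec k l = 0\<^sub>v k"
    using \<open>l < k\<close> by (intro eq_vecI) (auto simp: N_def)
  moreover have "unit_vec k l \<noteq> (0\<^sub>v k :: 'a vec)"
    using \<open>l < k\<close> by simp
  ultimately have "det N\<^sup>T = 0"
    using N by (subst det_0_iff_vec_prod_zero[of _ k]) (auto intro!: exI[of _ "unit_vec k l"])
  then have "det N = 0"
    using N by (simp add: det_transpose)
  then obtain x where x: "x \<in> carrier_vec k" "x \<noteq> 0\<^sub>v k" "N *\<^sub>v x = 0\<^sub>v k"
    using N by (auto simp: det_0_iff_vec_prod_zero)
  have "M *\<^sub>v x = 0\<^sub>v l"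
  proof (rule eq_vecI)
    fix i assume "i < dim_vec (0\<^sub>v l :: 'a vec)"
    then have i: "i < l" by simp
    have "row M i = row N i"
      using i M \<open>l < k\<close> by (intro eq_vecI) (auto simp: N_def)
    then have "(M *\<^sub>v x) $ i = (N *\<^sub>v x) $ i"
      using i M N \<open>l < k\<close> by simp
    then show "(M *\<^sub>v x) $ i = 0\<^sub>v l $ i"
      using i x \<open>l < k\<close> by simp
  qed (use M in auto)
  with x show ?thesis by blast
qed

text \<open>
  A linear map from a space to one of no larger dimension that misses a nonzero orthogonal direction
  \<open>u\<close> has rank less than the dimension of its domain.
\<close>

lemma not_onto_imp_not_inj:
  fixes M :: "'a :: field mat"
  assumes M: "M \<in> carrier_mat l k" and "l \<le> k"
    and u: "u \<in> carrier_vec l" "u \<noteq> 0\<^sub>v l" "M\<^sup>T *\<^sub>v u = 0\<^sub>v k"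
  shows "\<exists>x \<in> carrier_vec k. x \<noteq> 0\<^sub>v k \<and> M *\<^sub>v x = 0\<^sub>v l"
proof (cases "l = k")
  case True
  then have "det M\<^sup>T = 0"
    using M u by (subst det_0_iff_vec_prod_zero[of _ k]) auto
  then have "det M = 0"
    using M True by (simp add: det_transpose)
  then show ?thesis
    using M True by (auto simp: det_0_iff_vec_prod_zero)
next
  case False
  then show ?thesis
    using wide_mat_kernel_nontrivial[OF M] \<open>l \<le> k\<close> by simp
qed

text \<open>
  More than \<open>l\<close> vectors in \<open>F\<^sup>l\<close> satisfy a nontrivial linear relation; its scalar product with the
  \<open>p\<close>-th vector kills all terms except the \<open>p\<close>-th, which forces each coefficient to vanish.
\<close>

lemma orthogonal_list_length_le:
  fixes vs :: "'a :: linordered_field vec list"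
  assumes vs: "set vs \<subseteq> carrier_vec l - {0\<^sub>v l}"
    and orth: "sorted_wrt (\<lambda>u v. u \<bullet> v = 0) vs"
  shows "length vs \<le> l"
proof (rule ccontr)
  define m where "m = length vs"
  assume "\<not> length vs \<le> l"
  then have "l < m" by (simp add: m_def)
  have V: "mat_of_cols l vs \<in> carrier_mat l m"
    by (simp add: m_def)
  have vs_carrier: "vs ! p \<in> carrier_vec l" if "p < m" for p
    using vs nth_mem[of p vs] that unfolding m_def by blast
  obtain x where x: "x \<in> carrier_vec m" "x \<noteq> 0\<^sub>v m" "mat_of_cols l vs *\<^sub>v x = 0\<^sub>v l"
    using wide_mat_kernel_nontrivial[OF V \<open>l < m\<close>] by blast
  have "x $ p = 0" if p: "p < m" for p
  proof -
    have orth_p: "vs ! p \<bullet> vs ! j = 0" if "j < m" "j \<noteq> p" for j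
    proof (cases "p < j")
      case True
      then show ?thesis using orth that by (auto simp: sorted_wrt_iff_nth_less m_def)
    next
      case False
      then have "vs ! j \<bullet> vs ! p = 0"
        using orth that p by (auto simp: sorted_wrt_iff_nth_less m_def)
      then show ?thesis
        using comm_scalar_prod[OF vs_carrier[OF p] vs_carrier[OF that(1)]] by simp
    qed
    have "0 = ((mat_of_cols l vs)\<^sup>T *\<^sub>v (vs ! p)) \<bullet> x"
      using transpose_vec_mult_scalar[OF V x(1) vs_carrier[OF p]] x(3) vs_carrier[OF p] by simp
    also have "\<dots> = (\<Sum>j<m. (vs ! j \<bullet> vs ! p) * x $ j)"
      using x(1) vs_carrier by (auto simp: scalar_prod_def[of _ x] m_def lessThan_atLeast0 intro!: sum.cong)
    also have "\<dots> = (\<Sum>j<m. if j = p then (vs ! p \<bullet> vs ! p) * x $ p else 0)"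
      using orth_p comm_scalar_prod[OF vs_carrier vs_carrier] p by (intro sum.cong) auto
    also have "\<dots> = (vs ! p \<bullet> vs ! p) * x $ p"
      using p by simp
    finally have "(vs ! p \<bullet> vs ! p) * x $ p = 0" by simp
    moreover have "vs ! p \<noteq> 0\<^sub>v l"
      using vs nth_mem[of p vs] p unfolding m_def by blast
    ultimately show ?thesis
      using self_scalar_prod_eq_0[OF vs_carrier[OF p]] by auto
  qed
  then have "x = 0\<^sub>v m" using x(1) by auto
  with x(2) show False by contradiction
qed

text \<open>
  The factor is the inverse of the largest absolute value of a coordinate: after rescaling, all
  coordinates lie between \<open>-1\<close> and \<open>1\<close>, and one of them is \<open>1\<close> or \<open>-1\<close>. The bound \<open>l\<close> is a natural
  number, as the relation \<open>\<succeq>\<close> demands.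
\<close>

lemma exists_bounded_rescaling:
  fixes u :: "'a :: linordered_field vec"
  assumes u: "u \<in> carrier_vec l" "u \<noteq> 0\<^sub>v l"
  shows "\<exists>c. 1 \<le> (c \<cdot>\<^sub>v u) \<bullet> (c \<cdot>\<^sub>v u) \<and> (c \<cdot>\<^sub>v u) \<bullet> (c \<cdot>\<^sub>v u) \<le> of_nat l"
proof -
  have "\<exists>i<l. u $ i \<noteq> 0" using u by auto
  then have ne: "{..<l} \<noteq> {}" by auto
  define m where "m = Max ((\<lambda>i. \<bar>u $ i\<bar>) ` {..<l})"
  have le: "\<bar>u $ i\<bar> \<le> m" if "i < l" for i
    unfolding m_def using that by (intro Max_ge) auto
  have "m \<in> (\<lambda>i. \<bar>u $ i\<bar>) ` {..<l}"
    unfolding m_def using ne by (intro Max_in) auto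
  then obtain i where i: "i < l" "m = \<bar>u $ i\<bar>" by auto
  have m: "m > 0"
  proof -
    obtain j where "j < l" "u $ j \<noteq> 0" using \<open>\<exists>i<l. u $ i \<noteq> 0\<close> by blast
    then show ?thesis using le[of j] by auto
  qed
  define y where "y = (1 / m) \<cdot>\<^sub>v u"
  have y: "y \<bullet> y = (\<Sum>j<l. y $ j * y $ j)"
    using u by (auto simp: y_def scalar_prod_def lessThan_atLeast0)
  have y_le: "\<bar>y $ j\<bar> \<le> 1" if "j < l" for j
    using le[OF that] m that u by (auto simp: y_def abs_mult divide_simps)
  have "y $ j * y $ j \<le> 1" if "j < l" for j
    using y_le[OF that] by (metis abs_mult_self_eq abs_ge_zero mult_le_one)
  then have "y \<bullet> y \<le> (\<Sum>j<l. 1)"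
    unfolding y by (intro sum_mono) auto
  moreover have "y $ i * y $ i = 1"
    using i m u by (cases "u $ i \<ge> 0") (auto simp: y_def)
  then have "1 \<le> y \<bullet> y"
    unfolding y using i member_le_sum[of i "{..<l}" "\<lambda>j. y $ j * y $ j"] by simp
  ultimately show ?thesis
    unfolding y_def by (intro exI[of _ "1 / m"]) simp
qed

text \<open>
  Over an ordered field \<open>A A\<^sup>T w = 0\<close> implies \<open>|A\<^sup>T w|\<^sup>2 = 0\<close>, so the square matrix \<open>A A\<^sup>T\<close> is
  invertible, and \<open>A\<^sup>T (A A\<^sup>T)\<^bsup>-1\<^esup>\<close> is a right inverse of \<open>A\<close>.
\<close>

lemma right_inverse_if_transpose_inj:
  fixes A :: "'a :: linordered_field mat"
  assumes A: "A \<in> carrier_mat k n"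
    and inj: "\<And>w. w \<in> carrier_vec k \<Longrightarrow> A\<^sup>T *\<^sub>v w = 0\<^sub>v n \<Longrightarrow> w = 0\<^sub>v k"
  shows "\<exists>R \<in> carrier_mat n k. A * R = 1\<^sub>m k"
proof -
  have G: "A * A\<^sup>T \<in> carrier_mat k k" using A by simp
  have "det (A * A\<^sup>T) \<noteq> 0"
  proof
    assume "det (A * A\<^sup>T) = 0"
    then obtain w where w: "w \<in> carrier_vec k" "w \<noteq> 0\<^sub>v k" "(A * A\<^sup>T) *\<^sub>v w = 0\<^sub>v k"
      using G by (auto simp: det_0_iff_vec_prod_zero)
    have At: "A\<^sup>T \<in> carrier_mat n k" using A by simp
    have "(A\<^sup>T *\<^sub>v w) \<bullet> (A\<^sup>T *\<^sub>v w) = 0"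
      using scalar_prod_gram[OF At w(1)] w(1,3) by simp
    then have "A\<^sup>T *\<^sub>v w = 0\<^sub>v n"
      using At w by (intro self_scalar_prod_eq_0) auto
    then show False using inj w by blast
  qed
  then obtain X where X: "X \<in> carrier_mat k k" "(A * A\<^sup>T) * X = 1\<^sub>m k"
    using det_non_zero_imp_unit[OF G] by (auto simp: Units_def ring_mat_def)
  then have "A * (A\<^sup>T * X) = 1\<^sub>m k"
    using A by (simp add: assoc_mult_mat[of _ k n _ k _ k])
  then show ?thesis
    using A X by (intro bexI[of _ "A\<^sup>T * X"]) auto
qed

text \<open>
  This is where \<open>l \<le> k\<close> enters. If no \<open>w\<close> existed, \<open>A\<close> would have a right inverse \<open>R\<close>, and
  \<open>B R : F\<^sup>k \<rightarrow> F\<^sup>l\<close> would be injective because \<open>B R x = 0\<close> implies \<open>x = A R x = 0\<close>. But the image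
  of \<open>B R\<close> is orthogonal to \<open>u\<close>, so \<open>B R\<close> is not injective.
\<close>

lemma defect_transfers:
  fixes A B :: "'a :: linordered_field mat"
  assumes A: "A \<in> carrier_mat k n" and B: "B \<in> carrier_mat l n" and "l \<le> k"
    and ker: "\<And>v. v \<in> carrier_vec n \<Longrightarrow> B *\<^sub>v v = 0\<^sub>v l \<Longrightarrow> A *\<^sub>v v = 0\<^sub>v k"
    and u: "u \<in> carrier_vec l" "u \<noteq> 0\<^sub>v l" "B\<^sup>T *\<^sub>v u = 0\<^sub>v n"
  shows "\<exists>w \<in> carrier_vec k. w \<noteq> 0\<^sub>v k \<and> A\<^sup>T *\<^sub>v w = 0\<^sub>v n"
proof (rule ccontr)
  assume "\<not> ?thesis"
  then obtain R where R: "R \<in> carrier_mat n k" "A * R = 1\<^sub>m k"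
    using right_inverse_if_transpose_inj[OF A] by blast
  have "(B * R)\<^sup>T *\<^sub>v u = 0\<^sub>v k"
    using B R u by (simp add: transpose_mult[of _ l n _ k] assoc_mult_mat_vec[of _ k n _ l] mult_mat_zero_vec[of _ k n])
  then obtain x where x: "x \<in> carrier_vec k" "x \<noteq> 0\<^sub>v k" "(B * R) *\<^sub>v x = 0\<^sub>v l"
    using not_onto_imp_not_inj[of "B * R" l k u] B R u \<open>l \<le> k\<close> by auto
  have "B *\<^sub>v (R *\<^sub>v x) = 0\<^sub>v l"
    using x B R by (simp add: assoc_mult_mat_vec[of _ l n _ k])
  then have "A *\<^sub>v (R *\<^sub>v x) = 0\<^sub>v k"
    using ker R x by simp
  moreover have "A *\<^sub>v (R *\<^sub>v x) = x"
    using A R x by (metis assoc_mult_mat_vec one_mult_mat_vec)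
  ultimately show False using x by simp
qed


section \<open>The factorization when the columns of \<open>B\<close> span\<close>

lemma bibounded_factor_if_onto:
  fixes A B :: "'a :: linordered_field mat"
  assumes "k > 0" "l > 0" and A: "A \<in> carrier_mat k n" and B: "B \<in> carrier_mat l n"
    and sim: "mat_sim n A B"
    and onto: "\<And>u. u \<in> carrier_vec l \<Longrightarrow> B\<^sup>T *\<^sub>v u = 0\<^sub>v n \<Longrightarrow> u = 0\<^sub>v l"
  shows "\<exists>C. bibounded k l C \<and> A = C * B"
proof -
  obtain R where R: "R \<in> carrier_mat n l" "B * R = 1\<^sub>m l"
    using right_inverse_if_transpose_inj[OF B onto] by blast
  have BR: "B *\<^sub>v (R *\<^sub>v x) = x" if "x \<in> carrier_vec l" for x
    using B R that by (metis assoc_mult_mat_vec one_mult_mat_vec)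
  have AR: "(A * R) *\<^sub>v x = A *\<^sub>v (R *\<^sub>v x)" if "x \<in> carrier_vec l" for x
    using A R that by simp
  obtain r where r: "\<And>v. v \<in> carrier_vec n \<Longrightarrow>
      (A *\<^sub>v v) \<bullet> (A *\<^sub>v v) \<le> of_nat r * ((B *\<^sub>v v) \<bullet> (B *\<^sub>v v))"
    using sim mat_succeq_iff[OF assms(1,2) A B] by (auto simp: mat_sim_def)
  obtain s where s: "\<And>v. v \<in> carrier_vec n \<Longrightarrow>
      (B *\<^sub>v v) \<bullet> (B *\<^sub>v v) \<le> of_nat s * ((A *\<^sub>v v) \<bullet> (A *\<^sub>v v))"
    using sim mat_succeq_iff[OF assms(2,1) B A] by (auto simp: mat_sim_def)
  have C: "A * R \<in> carrier_mat k l" using A R by simp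
  have "((A * R) *\<^sub>v x) \<bullet> ((A * R) *\<^sub>v x) \<le> of_nat r * ((1\<^sub>m l *\<^sub>v x) \<bullet> (1\<^sub>m l *\<^sub>v x))"
    "(1\<^sub>m l *\<^sub>v x) \<bullet> (1\<^sub>m l *\<^sub>v x) \<le> of_nat s * (((A * R) *\<^sub>v x) \<bullet> ((A * R) *\<^sub>v x))"
    if "x \<in> carrier_vec l" for x
    using r[of "R *\<^sub>v x"] s[of "R *\<^sub>v x"] R that by (simp_all add: BR AR)
  then have "bibounded k l (A * R)"
    using C mat_succeq_iff[OF assms(1,2) C one_carrier_mat] mat_succeq_iff[OF assms(2,1) one_carrier_mat C]
    by (auto simp: bibounded_def mat_sim_def)
  moreover have "A = (A * R) * B"
  proof (rule mat_eq_if_mult_vec_eq[of _ k n])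
    fix v :: "'a vec" assume v: "v \<in> carrier_vec n"
    \<comment> \<open>\<open>v\<close> and \<open>R B v\<close> have the same image under \<open>B\<close>, and the kernel of \<open>B\<close> lies in that of \<open>A\<close>.\<close>
    define z where "z = v - R *\<^sub>v (B *\<^sub>v v)"
    have z: "z \<in> carrier_vec n" using v B R by (simp add: z_def)
    have "B *\<^sub>v z = 0\<^sub>v l"
      using v B R BR by (simp add: z_def mult_minus_distrib_mat_vec[of _ l n])
    then have "(A *\<^sub>v z) \<bullet> (A *\<^sub>v z) \<le> 0"
      using r[OF z] by simp
    then have "A *\<^sub>v z = 0\<^sub>v k"
      using A z self_scalar_prod_nonneg[of "A *\<^sub>v z"]
      by (intro self_scalar_prod_eq_0) auto
    moreover have "A *\<^sub>v v = A *\<^sub>v (z + R *\<^sub>v (B *\<^sub>v v))"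
      using v B R by (auto simp: z_def intro!: arg_cong[of _ _ "\<lambda>x. A *\<^sub>v x"])
    ultimately show "A *\<^sub>v v = ((A * R) * B) *\<^sub>v v"
      using A B R v z AR[of "B *\<^sub>v v"] assoc_mult_mat_vec[of "A * R" k l B n v]
      by (simp add: mult_add_distrib_mat_vec[of _ k n] del: assoc_mult_mat)
  qed (use A B R in auto)
  ultimately show ?thesis by blast
qed

section \<open>Adjoining an orthogonal column\<close>

definition adjoin_col :: "'a vec \<Rightarrow> 'a mat \<Rightarrow> 'a mat" where
  "adjoin_col w A = mat\<^sub>r (dim_row A) (Suc (dim_col A)) (\<lambda>i. vCons (w $ i) (row A i))"

lemma adjoin_col_carrier [simp]:
  "A \<in> carrier_mat k n \<Longrightarrow> adjoin_col w A \<in> carrier_mat k (Suc n)"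
  by (auto simp: adjoin_col_def)

lemma col_adjoin_col_0: "w \<in> carrier_vec (dim_row A) \<Longrightarrow> col (adjoin_col w A) 0 = w"
  by (intro eq_vecI) (auto simp: adjoin_col_def)

lemma col_adjoin_col_Suc: "j < dim_col A \<Longrightarrow> col (adjoin_col w A) (Suc j) = col A j"
  by (intro eq_vecI) (auto simp: adjoin_col_def)

lemma adjoin_col_mult_vCons:
  fixes A :: "'a :: comm_semiring_0 mat"
  assumes "A \<in> carrier_mat k n" "w \<in> carrier_vec k" "v \<in> carrier_vec n"
  shows "adjoin_col w A *\<^sub>v vCons a v = a \<cdot>\<^sub>v w + A *\<^sub>v v"
  using assms by (intro eq_vecI) (auto simp: adjoin_col_def mult.commute)

lemma transpose_adjoin_col_mult:
  fixes A :: "'a :: comm_semiring_0 mat"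
  assumes "A \<in> carrier_mat k n" "w \<in> carrier_vec k"
  shows "(adjoin_col w A)\<^sup>T *\<^sub>v y = vCons (w \<bullet> y) (A\<^sup>T *\<^sub>v y)"
proof (rule eq_vecI)
  have dims: "dim_row A = k" "dim_col A = n" "dim_vec w = k" "dim_col (adjoin_col w A) = Suc n"
    using assms carrier_matD(2)[OF adjoin_col_carrier[OF assms(1)]] by auto
  show "dim_vec ((adjoin_col w A)\<^sup>T *\<^sub>v y) = dim_vec (vCons (w \<bullet> y) (A\<^sup>T *\<^sub>v y))"
    by (simp add: dims)
  fix i assume "i < dim_vec (vCons (w \<bullet> y) (A\<^sup>T *\<^sub>v y))"
  then show "((adjoin_col w A)\<^sup>T *\<^sub>v y) $ i = vCons (w \<bullet> y) (A\<^sup>T *\<^sub>v y) $ i"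
    using assms by (cases i) (auto simp: dims col_adjoin_col_0 col_adjoin_col_Suc)
qed

lemma factor_from_adjoin_col:
  fixes A :: "'a :: comm_semiring_0 mat"
  assumes A: "A \<in> carrier_mat k n" and B: "B \<in> carrier_mat l n" and C: "C \<in> carrier_mat k l"
    and eq: "adjoin_col w A = C * adjoin_col u B"
  shows "A = C * B"
proof (rule mat_col_eqI)
  fix j assume "j < dim_col (C * B)"
  then have j: "j < n" using B by simp
  have "col A j = col (adjoin_col w A) (Suc j)"
    using A j by (simp add: col_adjoin_col_Suc)
  also have "\<dots> = C *\<^sub>v col (adjoin_col u B) (Suc j)"
    unfolding eq using adjoin_col_carrier[OF B, of u] C j by (intro col_mult2) auto
  also have "\<dots> = col (C * B) j"
    using B j by (simp add: col_adjoin_col_Suc col_mult2[OF C B j] del: col_mult)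
  finally show "col A j = col (C * B) j" .
qed (use A B C in auto)

lemma self_scalar_prod_orthogonal_sum:
  fixes A :: "'a :: linordered_field mat"
  assumes A: "A \<in> carrier_mat k n" and w: "w \<in> carrier_vec k" "A\<^sup>T *\<^sub>v w = 0\<^sub>v n"
    and v: "v \<in> carrier_vec n"
  shows "(a \<cdot>\<^sub>v w + A *\<^sub>v v) \<bullet> (a \<cdot>\<^sub>v w + A *\<^sub>v v)
    = a * a * (w \<bullet> w) + (A *\<^sub>v v) \<bullet> (A *\<^sub>v v)"
proof -
  have Av: "A *\<^sub>v v \<in> carrier_vec k" using A v by simp
  have 1: "w \<bullet> (A *\<^sub>v v) = 0"
    using transpose_vec_mult_scalar[OF A v w(1)] w v by simp
  then have 2: "(A *\<^sub>v v) \<bullet> w = 0"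
    using comm_scalar_prod[OF Av w(1)] by simp
  show ?thesis
    using Av w 1 2 by (simp add: add_scalar_prod_distrib[of _ k] scalar_prod_add_distrib[of _ k] algebra_simps)
qed

text \<open>
  By Pythagoras, the image of the vector \<open>v\<close> extended by the coordinate \<open>a\<close> has square length
  \<open>a\<^sup>2 |w|\<^sup>2 + |A v|\<^sup>2\<close>, respectively \<open>a\<^sup>2 |u|\<^sup>2 + |B v|\<^sup>2\<close>, and the two summands are compared
  separately.
\<close>

lemma mat_succeq_adjoin_col:
  fixes A B :: "'a :: linordered_field mat"
  assumes "k > 0" "l > 0" and A: "A \<in> carrier_mat k n" and B: "B \<in> carrier_mat l n"
    and succeq: "mat_succeq n A B"
    and w: "w \<in> carrier_vec k" "A\<^sup>T *\<^sub>v w = 0\<^sub>v n"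
    and u: "u \<in> carrier_vec l" "B\<^sup>T *\<^sub>v u = 0\<^sub>v n"
    and le: "w \<bullet> w \<le> of_nat c * (u \<bullet> u)"
  shows "mat_succeq (Suc n) (adjoin_col w A) (adjoin_col u B)"
proof -
  obtain r where r: "\<And>v. v \<in> carrier_vec n \<Longrightarrow>
      (A *\<^sub>v v) \<bullet> (A *\<^sub>v v) \<le> of_nat r * ((B *\<^sub>v v) \<bullet> (B *\<^sub>v v))"
    using succeq mat_succeq_iff[OF assms(1,2) A B] by auto
  have "(adjoin_col w A *\<^sub>v x) \<bullet> (adjoin_col w A *\<^sub>v x)
      \<le> of_nat (c + r) * ((adjoin_col u B *\<^sub>v x) \<bullet> (adjoin_col u B *\<^sub>v x))"
    if x: "x \<in> carrier_vec (Suc n)" for x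
  proof -
    obtain a v where x_eq: "x = vCons a v" and v: "v \<in> carrier_vec n"
      using x by (cases x) auto
    have "a * a * (w \<bullet> w) \<le> a * a * (of_nat c * (u \<bullet> u))"
      using le by (intro mult_left_mono) auto
    moreover have "0 \<le> a * a * (of_nat r * (u \<bullet> u))" "0 \<le> of_nat c * ((B *\<^sub>v v) \<bullet> (B *\<^sub>v v))"
      using self_scalar_prod_nonneg[of u] self_scalar_prod_nonneg[of "B *\<^sub>v v"] by simp_all
    ultimately show ?thesis
      using r[OF v]
      unfolding x_eq adjoin_col_mult_vCons[OF A w(1) v] adjoin_col_mult_vCons[OF B u(1) v]
        self_scalar_prod_orthogonal_sum[OF A w v] self_scalar_prod_orthogonal_sum[OF B u v]
      by (simp add: algebra_simps)
  qed
  then show ?thesis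
    using mat_succeq_iff[OF assms(1,2) adjoin_col_carrier[OF A] adjoin_col_carrier[OF B]] by blast
qed

section \<open>The general factorization\<close>

text \<open>
  The number \<open>d\<close> bounds the length of orthogonal lists in the complement of the column space of \<open>B\<close>.
  Adjoining a vector of that complement as a column lowers the bound by one, since an orthogonal
  list for the new matrix can be prolonged by this vector to one for the old matrix.
\<close>

lemma bibounded_factor_if_sim:
  fixes A B :: "'a :: linordered_field mat"
  assumes "k > 0" "l > 0" "l \<le> k" and "A \<in> carrier_mat k n" and "B \<in> carrier_mat l n"
    and "mat_sim n A B"
    and "\<And>vs. set vs \<subseteq> {u \<in> carrier_vec l. u \<noteq> 0\<^sub>v l \<and> B\<^sup>T *\<^sub>v u = 0\<^sub>v n} \<Longrightarrow>
      sorted_wrt (\<lambda>u v. u \<bullet> v = 0) vs \<Longrightarrow> length vs \<le> d"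
  shows "\<exists>C. bibounded k l C \<and> A = C * B"
  using assms(4-)
proof (induction d arbitrary: n A B)
  case 0
  have "u = 0\<^sub>v l" if "u \<in> carrier_vec l" "B\<^sup>T *\<^sub>v u = 0\<^sub>v n" for u
    using "0.prems"(4)[of "[u]"] that by auto
  then show ?case
    using bibounded_factor_if_onto[OF assms(1,2) "0.prems"(1-3)] by blast
next
  case (Suc d)
  note A = Suc.prems(1) and B = Suc.prems(2) and sim = Suc.prems(3)
  show ?case
  proof (cases "\<exists>u \<in> carrier_vec l. u \<noteq> 0\<^sub>v l \<and> B\<^sup>T *\<^sub>v u = 0\<^sub>v n")
    case False
    then show ?thesis
      using bibounded_factor_if_onto[OF assms(1,2) A B sim] by blast
  next
    case True
    then obtain u0 where u0: "u0 \<in> carrier_vec l" "u0 \<noteq> 0\<^sub>v l" "B\<^sup>T *\<^sub>v u0 = 0\<^sub>v n" by blast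
    obtain r where r: "\<And>v. v \<in> carrier_vec n \<Longrightarrow>
        (A *\<^sub>v v) \<bullet> (A *\<^sub>v v) \<le> of_nat r * ((B *\<^sub>v v) \<bullet> (B *\<^sub>v v))"
      using sim mat_succeq_iff[OF assms(1,2) A B] by (auto simp: mat_sim_def)
    have ker: "A *\<^sub>v v = 0\<^sub>v k" if "v \<in> carrier_vec n" "B *\<^sub>v v = 0\<^sub>v l" for v
    proof -
      have "(A *\<^sub>v v) \<bullet> (A *\<^sub>v v) = 0"
        using r[OF that(1)] that self_scalar_prod_nonneg[of "A *\<^sub>v v"] by simp
      then show ?thesis
        using A that by (intro self_scalar_prod_eq_0) auto
    qed
    obtain w0 where w0: "w0 \<in> carrier_vec k" "w0 \<noteq> 0\<^sub>v k" "A\<^sup>T *\<^sub>v w0 = 0\<^sub>v n"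
      using defect_transfers[OF A B \<open>l \<le> k\<close> ker u0] by blast
    obtain a where a: "1 \<le> (a \<cdot>\<^sub>v u0) \<bullet> (a \<cdot>\<^sub>v u0)" "(a \<cdot>\<^sub>v u0) \<bullet> (a \<cdot>\<^sub>v u0) \<le> of_nat l"
      using exists_bounded_rescaling[OF u0(1,2)] by blast
    obtain b where b: "1 \<le> (b \<cdot>\<^sub>v w0) \<bullet> (b \<cdot>\<^sub>v w0)" "(b \<cdot>\<^sub>v w0) \<bullet> (b \<cdot>\<^sub>v w0) \<le> of_nat k"
      using exists_bounded_rescaling[OF w0(1,2)] by blast
    define u where "u = a \<cdot>\<^sub>v u0"
    define w where "w = b \<cdot>\<^sub>v w0"
    have u: "u \<in> carrier_vec l" "B\<^sup>T *\<^sub>v u = 0\<^sub>v n"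
      using u0 B by (auto simp: u_def mult_mat_vec[of _ n l])
    have w: "w \<in> carrier_vec k" "A\<^sup>T *\<^sub>v w = 0\<^sub>v n"
      using w0 A by (auto simp: w_def mult_mat_vec[of _ n k])
    have u_ne: "u \<noteq> 0\<^sub>v l"
      using a(1) by (auto simp: u_def[symmetric])
    \<comment> \<open>\<open>|w|\<^sup>2 \<le> k \<le> k |u|\<^sup>2\<close> and \<open>|u|\<^sup>2 \<le> l \<le> l |w|\<^sup>2\<close>\<close>
    have "of_nat k * 1 \<le> of_nat k * (u \<bullet> u)" "of_nat l * 1 \<le> of_nat l * (w \<bullet> w)"
      using a b by (auto simp only: u_def w_def intro!: mult_left_mono)
    then have "w \<bullet> w \<le> of_nat k * (u \<bullet> u)" "u \<bullet> u \<le> of_nat l * (w \<bullet> w)"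
      using a b by (auto simp only: u_def w_def mult_1_right intro: order_trans)
    then have sim': "mat_sim (Suc n) (adjoin_col w A) (adjoin_col u B)"
      using sim mat_succeq_adjoin_col[OF assms(1,2) A B _ w u]
        mat_succeq_adjoin_col[OF assms(2,1) B A _ u w] by (auto simp: mat_sim_def)
    have "length vs \<le> d"
      if vs: "set vs \<subseteq> {y \<in> carrier_vec l. y \<noteq> 0\<^sub>v l \<and> (adjoin_col u B)\<^sup>T *\<^sub>v y = 0\<^sub>v (Suc n)}"
        and orth: "sorted_wrt (\<lambda>u v. u \<bullet> v = 0) vs" for vs
    proof -
      have "u \<bullet> y = 0 \<and> B\<^sup>T *\<^sub>v y = 0\<^sub>v n" if "y \<in> set vs" for y
        using vs that by (auto simp: transpose_adjoin_col_mult[OF B u(1)] zero_vec_Suc)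
      then have "length (u # vs) \<le> Suc d"
        using vs orth u u_ne by (intro Suc.prems(4)) auto
      then show ?thesis by simp
    qed
    then obtain C where C: "bibounded k l C" "adjoin_col w A = C * adjoin_col u B"
      using Suc.IH[OF adjoin_col_carrier[OF A] adjoin_col_carrier[OF B] sim'] by blast
    then have "A = C * B"
      using factor_from_adjoin_col[OF A B _ C(2)] by (auto simp: bibounded_def)
    with C show ?thesis by blast
  qed
qed

section \<open>Bibounded multiples and the equivalence\<close>

lemma mat_sim_bibounded_mult:
  fixes B :: "'a :: linordered_field mat"
  assumes "k > 0" "l > 0" and B: "B \<in> carrier_mat l n" and bib: "bibounded k l C"
  shows "mat_sim n (C * B) B"
proof -
  have C: "C \<in> carrier_mat k l" using bib by (simp add: bibounded_def)
  have CB: "C * B \<in> carrier_mat k n" using B C by simp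
  have "mat_succeq l C (1\<^sub>m l)" "mat_succeq l (1\<^sub>m l) C"
    using bib by (auto simp: bibounded_def mat_sim_def)
  then obtain r s :: nat where
    r: "\<And>x. x \<in> carrier_vec l \<Longrightarrow> (C *\<^sub>v x) \<bullet> (C *\<^sub>v x) \<le> of_nat r * (x \<bullet> x)" and
    s: "\<And>x. x \<in> carrier_vec l \<Longrightarrow> x \<bullet> x \<le> of_nat s * ((C *\<^sub>v x) \<bullet> (C *\<^sub>v x))"
    using mat_succeq_iff[OF assms(1,2) C one_carrier_mat] mat_succeq_iff[OF assms(2,1) one_carrier_mat C]
    by auto
  have "(C * B) *\<^sub>v v = C *\<^sub>v (B *\<^sub>v v)" if "v \<in> carrier_vec n" for v
    using B C that by simp
  then have "((C * B) *\<^sub>v v) \<bullet> ((C * B) *\<^sub>v v) \<le> of_nat r * ((B *\<^sub>v v) \<bullet> (B *\<^sub>v v))"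
    "(B *\<^sub>v v) \<bullet> (B *\<^sub>v v) \<le> of_nat s * (((C * B) *\<^sub>v v) \<bullet> ((C * B) *\<^sub>v v))"
    if "v \<in> carrier_vec n" for v
    using r[of "B *\<^sub>v v"] s[of "B *\<^sub>v v"] B that by simp_all
  then show ?thesis
    unfolding mat_sim_def mat_succeq_iff[OF assms(1,2) CB B] mat_succeq_iff[OF assms(2,1) B CB]
    by blast
qed

theorem proposition5p2:
  fixes A B :: "'a :: linordered_field mat" and k l n :: nat
  assumes "k > 0" and "l > 0" and "n > 0" and "k \<ge> l"
    and "A \<in> carrier_mat k n" and "B \<in> carrier_mat l n"
  shows "mat_sim n A B \<longleftrightarrow> (\<exists>C. bibounded k l C \<and> A = C * B)"
proof
  assume "mat_sim n A B"
  moreover have "length vs \<le> l"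
    if "set vs \<subseteq> {u \<in> carrier_vec l. u \<noteq> 0\<^sub>v l \<and> B\<^sup>T *\<^sub>v u = 0\<^sub>v n}"
      and "sorted_wrt (\<lambda>u v. u \<bullet> v = 0) vs" for vs
    using orthogonal_list_length_le[of vs l] that by blast
  ultimately show "\<exists>C. bibounded k l C \<and> A = C * B"
    using bibounded_factor_if_sim[OF assms(1,2,4,5,6)] by blast
next
  assume "\<exists>C. bibounded k l C \<and> A = C * B"
  then show "mat_sim n A B"
    using mat_sim_bibounded_mult[OF assms(1,2,6)] by blast
qed

end
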